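(* Let $(X,d)$ be a locally compact, non-compact, separable ultrametric space. Let $M\subset[0,\infty)$ be a countable unbounded set which contains $0$. Assume that if $X$ contains a non-isolated point, then $0$ is an accumulation point of $M$. Then the following hold. (1) There exists a proper ultrametric $d'$ on $X$ which generates the same topology as $d$ and such that $\operatorname{Range}(d')=M$. (2) Assume in addition that $d$ is proper and that there exists a partition $\Pi$ of $X$ made of $d$-balls which contains infinitely many non-singletons. Then the ultrametric $d'$ as in (1) can be chosen such that, moreover, the collections of $d$-balls and of $d'$-balls coincide.
   Context: An ultrametric is a metric $d$ with $d(x,y)\le\max\{d(x,z),d(z,y)\}$ for all $x,y,z$. A metric $d$ on $X$ is called proper if every closed ball $\{x\in X: d(x,a)\le r\}$ is compact. A $d$-ball is a set $B_r(a)=\{x\in X: d(x,a)<r\}$ with $a\in X$, $r>0$. $\operatorname{Range}(d')=\{d'(x,y):x,y\in X\}$ is the set of all values of $d'$. *)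

theory Defs
  imports "HOL-Analysis.Analysis" "HOL-Library.Disjoint_Sets"
begin

locale Ultrametric_space = Metric_space +
  assumes ultrametric:
    "\<And>x y z. \<lbrakk>x \<in> M; y \<in> M; z \<in> M\<rbrakk> \<Longrightarrow> d x y \<le> max (d x z) (d z y)"

context Metric_space
begin

definition proper_metric :: bool where
  "proper_metric \<longleftrightarrow> (\<forall>a\<in>M. \<forall>r. compactin mtopology (mcball a r))"

text \<open>Balls are plain sets: one ball may have many centres and radii.\<close>

definition mballs :: "'a set set" where
  "mballs = {mball a r | a r. a \<in> M \<and> 0 < r}"

definition dist_range :: "real set" where
  "dist_range = {d x y | x y. x \<in> M \<and> y \<in> M}"

end

end

theory Submission
  imports Defs
begin

text \<open>For a proper ultrametric d the non-singleton balls are the nodes, i.e. the sets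
  {z. d x z \<le> d x y} with x \<noteq> y, and they form a tree. Any strictly increasing weight f on the nodes
  gives an ultrametric d' x y = f (node x y) with the same balls; it has range M and the right
  topology if f maps onto M - {0}, is unbounded along ascending chains, and tends to 0 along chains
  descending to a non-isolated point. Such an f is built from the given partition: on its infinitely
  many non-singleton cells f is an arbitrary surjection onto M - {0}; this prescribes finitely many
  lower bounds for the weight of a node above the cells and one upper bound for that of a node
  inside a cell, which leaves enough room in M because M is unbounded and, if needed, accumulates at
  0. For the first claim, an exhaustion by compact open sets yields some proper ultrametric and a
  partition of this kind.\<close>

section \<open>Disjoint open covers of compact sets, and comparison of metric topologies\<close>

text \<open>A finite subcover already contains every member that meets \<open>K\<close>: a point of
  \<open>K\<close> in \<open>U\<close> lies in some member of the subcover, and disjointness forces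
  that member to be \<open>U\<close>.\<close>

lemma finite_disjoint_open_meeting_compact:
  assumes K: "compactin T K" and op: "\<And>U. U \<in> \<U> \<Longrightarrow> openin T U"
    and cov: "K \<subseteq> \<Union>\<U>" and disj: "disjoint \<U>"
  shows "finite {U \<in> \<U>. U \<inter> K \<noteq> {}}"
proof -
  obtain \<F> where F: "finite \<F>" "\<F> \<subseteq> \<U>" "K \<subseteq> \<Union>\<F>"
    using K op cov unfolding compactin_def by metis
  have "{U \<in> \<U>. U \<inter> K \<noteq> {}} \<subseteq> \<F>"
  proof
    fix U assume U: "U \<in> {U \<in> \<U>. U \<inter> K \<noteq> {}}"
    then obtain x where x: "x \<in> U" "x \<in> K" by blast
    then obtain V where V: "V \<in> \<F>" "x \<in> V" using F by blast
    then have "U = V"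
      using U x(1) F(2) disjointD[OF disj, of U V] by auto
    then show "U \<in> \<F>" using V by simp
  qed
  then show ?thesis using F(1) finite_subset by blast
qed

lemma mtopology_eqI:
  assumes "Metric_space X d" "Metric_space X d'"
    and 1: "\<And>x e. \<lbrakk>x \<in> X; e > 0\<rbrakk> \<Longrightarrow> \<exists>\<delta>>0. \<forall>y\<in>X. d x y < \<delta> \<longrightarrow> d' x y < e"
    and 2: "\<And>x e. \<lbrakk>x \<in> X; e > 0\<rbrakk> \<Longrightarrow> \<exists>\<delta>>0. \<forall>y\<in>X. d' x y < \<delta> \<longrightarrow> d x y < e"
  shows "Metric_space.mtopology X d' = Metric_space.mtopology X d"
proof -
  interpret A: Metric_space X d by fact
  interpret B: Metric_space X d' by fact
  have "openin B.mtopology U = openin A.mtopology U" for U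
  proof
    assume U: "openin B.mtopology U"
    show "openin A.mtopology U"
      unfolding A.openin_mtopology
    proof (intro conjI allI impI)
      show UX: "U \<subseteq> X" using U unfolding B.openin_mtopology by blast
      fix x assume x: "x \<in> U"
      then obtain e where e: "e > 0" "B.mball x e \<subseteq> U" 
        using U unfolding B.openin_mtopology by blast
      obtain \<delta> where "\<delta> > 0" "\<forall>y\<in>X. d x y < \<delta> \<longrightarrow> d' x y < e"
        using 1 e x UX by blast
      then have "A.mball x \<delta> \<subseteq> U"
        using e by (auto simp: A.in_mball B.in_mball subset_iff)
      then show "\<exists>r>0. A.mball x r \<subseteq> U" using \<open>\<delta> > 0\<close> by blast
    qed
  next
    assume U: "openin A.mtopology U"
    show "openin B.mtopology U"
      unfolding B.openin_mtopology
    proof (intro conjI allI impI)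
      show UX: "U \<subseteq> X" using U unfolding A.openin_mtopology by blast
      fix x assume x: "x \<in> U"
      then obtain e where e: "e > 0" "A.mball x e \<subseteq> U" 
        using U unfolding A.openin_mtopology by blast
      obtain \<delta> where "\<delta> > 0" "\<forall>y\<in>X. d' x y < \<delta> \<longrightarrow> d x y < e"
        using 2 e x UX by blast
      then have "B.mball x \<delta> \<subseteq> U"
        using e by (auto simp: A.in_mball B.in_mball subset_iff)
      then show "\<exists>r>0. B.mball x r \<subseteq> U" using \<open>\<delta> > 0\<close> by blast
    qed
  qed
  then show ?thesis by (simp add: topology_eq)
qed

section \<open>Balls and distances in ultrametric spaces\<close>

context Ultrametric_space
begin

lemma openin_mcball:
  assumes "r > 0" shows "openin mtopology (mcball x r)"
  unfolding openin_mtopology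
proof (intro conjI allI impI)
  fix y assume y: "y \<in> mcball x r"
  have "mball y r \<subseteq> mcball x r"
  proof
    fix z assume z: "z \<in> mball y r"
    then show "z \<in> mcball x r"
      using ultrametric[of x z y] y by auto
  qed
  then show "\<exists>r'>0. mball y r' \<subseteq> mcball x r" using assms by blast
qed auto

text \<open>If the balls of radius \<open>r\<close> around \<open>x\<close> and \<open>y\<close> had
  a common point \<open>z\<close>, the ultrametric inequality through \<open>z\<close> would put
  \<open>y\<close> into the first ball.\<close>

lemma closedin_mball: "closedin mtopology (mball x r)"
  unfolding closedin_metric
proof (intro conjI allI impI)
  fix y assume y: "y \<in> M - mball x r"
  show "\<exists>e>0. disjnt (mball x r) (mball y e)"
  proof (cases "x \<in> M \<and> r > 0")
    case True
    have "disjnt (mball x r) (mball y r)"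
      unfolding disjnt_iff
    proof (intro allI notI)
      fix z assume z: "z \<in> mball x r \<and> z \<in> mball y r"
      then show False
        using ultrametric[of x y z] y commute[of y z] by auto
    qed
    then show ?thesis using True by blast
  next
    case False
    then have "mball x r = {}" by (auto simp: mball_eq_empty)
    then show ?thesis by (auto intro: exI[of _ 1])
  qed
qed auto

text \<open>The spheres around \<open>x\<close> of radius at least \<open>s\<close>, together with
  the ball of radius \<open>s\<close>, split the space into open pieces. Only finitely many of them
  meet a compact closed ball, and each distance in question names its own sphere.\<close>

lemma finite_distances:
  assumes proper_metric and x: "x \<in> M" and s: "0 < s"
  shows "finite {d x y | y. y \<in> M \<and> s \<le> d x y \<and> d x y \<le> r}"
proof -
  \<comment> \<open>All radii below \<open>s\<close> share one piece, because the sphere of radius 0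
    is \<open>{x}\<close>, which need not be open.\<close>
  define L where "L = (\<lambda>t. if s \<le> t then {y \<in> M. d x y = t} else mball x s)"
  have K: "compactin mtopology (mcball x r)"
    using assms unfolding proper_metric_def by blast
  have op: "openin mtopology (L t)" for t
  proof (cases "s \<le> t")
    case True
    have "\<exists>e>0. mball y e \<subseteq> L t" if y: "y \<in> L t" for y
    proof (intro exI conjI)
      show "t > 0" using True s by linarith
      \<comment> \<open>If \<open>d y z < t = d x y\<close>, the two longest sides of the triangle
        \<open>x\<close>, \<open>y\<close>, \<open>z\<close> are equal, so
        \<open>d x z = t\<close>.\<close>
      show "mball y t \<subseteq> L t"
      proof
        fix z assume z: "z \<in> mball y t"
        show "z \<in> L t"
          using ultrametric[of x z y] ultrametric[of x y z] commute[of y z] y z x True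
          by (auto simp: L_def)
      qed
    qed
    moreover have "L t \<subseteq> M" using True by (auto simp: L_def)
    ultimately show ?thesis unfolding openin_mtopology by blast
  qed (simp add: L_def)
  have "finite {U \<in> range L. U \<inter> mcball x r \<noteq> {}}"
  proof (rule finite_disjoint_open_meeting_compact[OF K])
    show "mcball x r \<subseteq> \<Union>(range L)"
    proof
      fix y assume "y \<in> mcball x r"
      then have "y \<in> L (d x y)" using x by (auto simp: L_def)
      then show "y \<in> \<Union>(range L)" by blast
    qed
    show "disjoint (range L)"
      unfolding disjoint_def by (auto simp: L_def)
  qed (use op in auto)
  moreover have "L ` {d x y | y. y \<in> M \<and> s \<le> d x y \<and> d x y \<le> r}
      \<subseteq> {U \<in> range L. U \<inter> mcball x r \<noteq> {}}"
    using x by (auto simp: L_def)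
  ultimately have "finite (L ` {d x y | y. y \<in> M \<and> s \<le> d x y \<and> d x y \<le> r})"
    using finite_subset by blast
  moreover have "inj_on L {d x y | y. y \<in> M \<and> s \<le> d x y \<and> d x y \<le> r}"
  proof (rule inj_onI)
    fix u v assume "u \<in> {d x y | y. y \<in> M \<and> s \<le> d x y \<and> d x y \<le> r}"
      and v: "v \<in> {d x y | y. y \<in> M \<and> s \<le> d x y \<and> d x y \<le> r}" and L: "L u = L v"
    then obtain y where "y \<in> M" "u = d x y" "s \<le> d x y" by blast
    then have "y \<in> L u" by (auto simp: L_def)
    then have "y \<in> L v" using L by simp
    then show "u = v" using \<open>u = d x y\<close> v by (auto simp: L_def)
  qed
  ultimately show ?thesis using finite_imageD by blast
qed

section \<open>The tree of non-singleton balls\<close>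

text \<open>This is the smallest ball containing both \<open>x\<close> and \<open>y\<close>, hence
  symmetric in them; in the tree it is the place where the branches to \<open>x\<close> and
  \<open>y\<close> part.\<close>

definition node :: "'a \<Rightarrow> 'a \<Rightarrow> 'a set" where
  "node x y = mcball x (d x y)"

definition nodes :: "'a set set" where
  "nodes = {node x y | x y. x \<in> M \<and> y \<in> M \<and> x \<noteq> y}"

lemma node_in_nodes: "\<lbrakk>x \<in> M; y \<in> M; x \<noteq> y\<rbrakk> \<Longrightarrow> node x y \<in> nodes"
  unfolding nodes_def by blast

lemma node_commute:
  assumes "x \<in> M" "y \<in> M" shows "node x y = node y x"
proof -
  have "z \<in> node y x" if "z \<in> node x y" "x \<in> M" "y \<in> M" for x y z
    using that ultrametric[of y z x] commute[of x y] by (auto simp: node_def)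
  then show ?thesis using assms by blast
qed

lemma in_node: "\<lbrakk>x \<in> M; y \<in> M\<rbrakk> \<Longrightarrow> x \<in> node x y" "\<lbrakk>x \<in> M; y \<in> M\<rbrakk> \<Longrightarrow> y \<in> node x y"
  by (auto simp: node_def)

lemma node_subset_iff:
  "\<lbrakk>x \<in> M; y \<in> M; z \<in> M\<rbrakk> \<Longrightarrow> node x y \<subseteq> node x z \<longleftrightarrow> d x y \<le> d x z"
  using in_node(2)[of x y] by (auto simp: node_def)

lemma node_psubset_iff:
  "\<lbrakk>x \<in> M; y \<in> M; z \<in> M\<rbrakk> \<Longrightarrow> node x y \<subset> node x z \<longleftrightarrow> d x y < d x z"
  using node_subset_iff[of x y z] node_subset_iff[of x z y] by auto

text \<open>Every point of an ultrametric ball is a centre. In the node of \<open>a\<close> and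
  \<open>b\<close>, either \<open>d a x = d a b\<close> and \<open>a\<close> is a partner for
  \<open>x\<close>, or \<open>d a x < d a b\<close> and the isosceles property gives
  \<open>d x b = d a b\<close>, so \<open>b\<close> is one.\<close>

lemma nodes_centre:
  assumes "A \<in> nodes" "x \<in> A"
  obtains y where "y \<in> M" "y \<noteq> x" "A = node x y"
proof -
  obtain a b where ab: "a \<in> M" "b \<in> M" "a \<noteq> b" "A = node a b"
    using assms unfolding nodes_def by blast
  have x: "x \<in> M" "d a x \<le> d a b" using assms(2) ab by (auto simp: node_def)
  have eq: "node a x = node a b" if "d a x = d a b" using that by (simp add: node_def)
  show thesis
  proof (cases "d a x = d a b")
    case True
    then show thesis using that[of a] ab x eq node_commute[of a x] by (metis zero)
  next
    case False
    then have 1: "d a b = d x b"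
      using ultrametric[of a b x] ultrametric[of x b a] x ab commute[of x a] by auto
    then have "node x b = node b a"
      using node_commute[of x b] x ab commute by (simp add: node_def)
    then show thesis using that[of b] 1 ab x False node_commute[of a b] by metis
  qed
qed

lemma nodes_subset: "A \<in> nodes \<Longrightarrow> A \<subseteq> M"
  by (auto simp: nodes_def node_def)

lemma nodes_two_points:
  assumes "A \<in> nodes" obtains x y where "x \<in> A" "y \<in> A" "x \<noteq> y" "A = node x y"
  using assms in_node unfolding nodes_def by blast

text \<open>Both nodes can be centred at a common point, and then their radii decide the
  inclusion.\<close>

lemma nodes_nested:
  assumes "A \<in> nodes" "B \<in> nodes" "A \<inter> B \<noteq> {}" shows "A \<subseteq> B \<or> B \<subseteq> A"
proof -
  obtain x where x: "x \<in> A" "x \<in> B" using assms by blast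
  obtain y where y: "y \<in> M" "A = node x y" using nodes_centre assms x by metis
  obtain z where z: "z \<in> M" "B = node x z" using nodes_centre assms x by metis
  have "x \<in> M" using x nodes_subset assms by blast
  then show ?thesis using y z node_subset_iff linear by metis
qed

lemma nodes_openin: "A \<in> nodes \<Longrightarrow> openin mtopology A"
  by (auto simp: nodes_def node_def intro!: openin_mcball)

lemma nodes_compactin: "proper_metric \<Longrightarrow> A \<in> nodes \<Longrightarrow> compactin mtopology A"
  unfolding proper_metric_def nodes_def node_def by blast

text \<open>By \<open>finite_distances\<close>, positive distances from a point do not accumulate at
  a positive value, so open and closed balls with more than one point are the same sets. The
  right-hand side depends only on the nodes and the topology, which is how two metrics are later
  shown to have equal balls.\<close>

lemma mballs_eq_nodes_Un_singletons:
  assumes P: proper_metric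
  shows "mballs = nodes \<union> {{a} | a. openin mtopology {a}}"
proof (intro equalityI subsetI)
  fix B assume "B \<in> mballs"
  then obtain a r where B: "B = mball a r" "a \<in> M" "0 < r" unfolding mballs_def by blast
  show "B \<in> nodes \<union> {{a} | a. openin mtopology {a}}"
  proof (cases "B = {a}")
    case True
    then show ?thesis using B(1) openin_mball[of a r] by auto
  next
    case False
    moreover have "a \<in> B" using B by auto
    ultimately obtain z where "z \<in> B" "z \<noteq> a" by blast
    then have z: "z \<in> M" "z \<noteq> a" "d a z < r" using B by auto
    \<comment> \<open>The cutoff \<open>d a z > 0\<close> makes this set finite; its maximum is the
      largest distance from \<open>a\<close> attained inside \<open>B\<close>.\<close>
    let ?S = "{t \<in> {d a y | y. y \<in> M \<and> d a z \<le> d a y \<and> d a y \<le> r}. t < r}"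
    have fin: "finite ?S" using finite_distances[OF P B(2), of "d a z" r] z B(2) by simp
    have "d a z \<in> ?S" using z by auto
    then have ne: "?S \<noteq> {}" by blast
    have "Max ?S \<in> ?S" by (rule Max_in[OF fin ne])
    then obtain y where y: "y \<in> M" "d a z \<le> d a y" "d a y < r" "Max ?S = d a y"
      by auto
    have le: "d a w \<le> d a y" if "w \<in> M" "d a w < r" for w
    proof (cases "d a z \<le> d a w")
      case True
      then have "d a w \<in> ?S" using that by auto
      then have "d a w \<le> Max ?S" by (rule Max_ge[OF fin])
      then show ?thesis unfolding y(4) .
    qed (use y in linarith)
    have "B = node a y"
      using le y(1,3) B(1,2) by (auto simp: node_def intro: le_less_trans)
    moreover have "d a z > 0" using z B(2) by simp
    then have "a \<noteq> y" using y(1,2) by auto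
    ultimately show ?thesis using node_in_nodes B y by auto
  qed
next
  fix B assume B: "B \<in> nodes \<union> {{a} | a. openin mtopology {a}}"
  show "B \<in> mballs"
  proof (cases "B \<in> nodes")
    case True
    then obtain x y where xy: "x \<in> M" "y \<in> M" "x \<noteq> y" "B = node x y" 
      unfolding nodes_def by blast
    define t where "t = d x y"
    have t: "t > 0" using xy t_def by auto
    \<comment> \<open>The next distance after \<open>t\<close> becomes the open radius. The cap
      \<open>t + 1\<close> keeps the set finite and supplies a radius if no distance lies just above
      \<open>t\<close>.\<close>
    let ?S = "{u \<in> {d x y | y. y \<in> M \<and> t \<le> d x y \<and> d x y \<le> t+1}. t < u}"
    have fin: "finite (insert (t+1) ?S)" using finite_distances[OF P xy(1) t] by simp
    define r where "r = Min (insert (t+1) ?S)"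
    have rt: "r > t" unfolding r_def using fin by (subst Min_gr_iff) auto
    have le: "d x z \<le> t" if z: "z \<in> M" "d x z < r" for z
    proof (rule ccontr)
      assume n: "\<not> d x z \<le> t"
      have "r \<le> t + 1" unfolding r_def by (rule Min_le[OF fin]) simp
      then have "d x z \<in> ?S" using n z by auto
      then have "r \<le> d x z" unfolding r_def by (intro Min_le[OF fin] insertI2)
      then show False using z by simp
    qed
    then have "B = mball x r" using rt le xy by (auto simp: node_def t_def[symmetric])
    then show ?thesis using less_trans[OF t rt] xy(1) unfolding mballs_def by blast
  next
    case False
    then obtain a where a: "B = {a}" "openin mtopology {a}" using B by blast
    then obtain r where "r > 0" "mball a r \<subseteq> {a}" "a \<in> M"
      unfolding openin_mtopology by blast
    then have "B = mball a r" using a by auto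
    then show ?thesis using \<open>r > 0\<close> \<open>a \<in> M\<close> unfolding mballs_def by blast
  qed
qed


text \<open>All nodes between \<open>A\<close> and \<open>C\<close> can be centred at one point of
  \<open>A\<close>, so they correspond to distances from it between two positive bounds.\<close>

lemma finite_nodes_between:
  assumes P: proper_metric and "A \<in> nodes" "C \<in> nodes"
  shows "finite {B \<in> nodes. A \<subseteq> B \<and> B \<subseteq> C}"
proof (cases "A \<subseteq> C")
  case True
  obtain x where x: "x \<in> A" using assms nodes_two_points by metis
  obtain y where y: "y \<in> M" "y \<noteq> x" "A = node x y" using nodes_centre assms x by metis
  obtain w where w: "w \<in> M" "C = node x w" using nodes_centre[of C x] assms(3) x True by auto
  have xM: "x \<in> M" using x nodes_subset assms by blast
  have "{B \<in> nodes. A \<subseteq> B \<and> B \<subseteq> C}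
      \<subseteq> mcball x ` {d x z | z. z \<in> M \<and> d x y \<le> d x z \<and> d x z \<le> d x w}"
  proof
    fix B assume B: "B \<in> {B \<in> nodes. A \<subseteq> B \<and> B \<subseteq> C}"
    then have "B \<in> nodes" "x \<in> B" using x by auto
    then obtain z where z: "z \<in> M" "B = node x z" by (rule nodes_centre)
    then have "d x y \<le> d x z" "d x z \<le> d x w"
      using B y w xM node_subset_iff by auto
    then show "B \<in> mcball x ` {d x z | z. z \<in> M \<and> d x y \<le> d x z \<and> d x z \<le> d x w}"
      using z unfolding node_def by blast
  qed
  moreover have "finite {d x z | z. z \<in> M \<and> d x y \<le> d x z \<and> d x z \<le> d x w}"
    using finite_distances[OF P xM] xM y by auto
  ultimately show ?thesis using finite_subset by blast
next
  case False
  then have "{B \<in> nodes. A \<subseteq> B \<and> B \<subseteq> C} = {}" by blast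
  then show ?thesis by (simp only: finite.emptyI)
qed

text \<open>The open ball around \<open>x\<close> with the radius of \<open>A\<close> contains a
  further point \<open>z\<close>, since \<open>x\<close> is not isolated; the node of
  \<open>x\<close> and \<open>z\<close> is strictly smaller.\<close>

lemma smaller_node:
  assumes "\<not> openin mtopology {x}" "A \<in> nodes" "x \<in> A"
  obtains B where "B \<in> nodes" "x \<in> B" "B \<subset> A"
proof -
  obtain y where y: "y \<in> M" "y \<noteq> x" "A = node x y" using nodes_centre assms by metis
  have xM: "x \<in> M" using assms nodes_subset by blast
  have "x \<in> mball x (d x y)" using xM y by auto
  moreover have "mball x (d x y) \<noteq> {x}" using assms(1) openin_mball by metis
  ultimately obtain z where z: "z \<in> mball x (d x y)" "z \<noteq> x" by blast
  then show thesis
    using that[of "node x z"] y xM node_in_nodes node_psubset_iff in_node by auto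
qed

lemma unbounded_distances:
  assumes P: proper_metric and "\<not> compact_space mtopology" and x: "x \<in> M"
  obtains y where "y \<in> M" "r < d x y"
proof -
  have "compactin mtopology (mcball x r)" using P x unfolding proper_metric_def by blast
  then have "mcball x r \<noteq> M" using assms(2) unfolding compact_space_def by auto
  then have "\<not> M \<subseteq> mcball x r" using mcball_subset_mspace by blast
  then obtain y where "y \<in> M" "y \<notin> mcball x r" by blast
  then show thesis using that x by (auto simp: not_le)
qed

section \<open>Changing the metric through node weights\<close>

text \<open>Replacing every distance by a strictly increasing weight of the corresponding node keeps the
  order of the distances from each point, hence the balls.\<close>

lemma remetrize:
  assumes P: proper_metric and ne: "M \<noteq> {}"
    and mono: "\<And>A B. \<lbrakk>A \<in> nodes; B \<in> nodes; A \<subset> B\<rbrakk> \<Longrightarrow> f A < f B"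
    and R: "f ` nodes = R - {0}" "R \<subseteq> {0..}" "(0::real) \<in> R"
    and large: "\<And>x r. x \<in> M \<Longrightarrow> \<exists>A\<in>nodes. x \<in> A \<and> r < f A"
    and small: "\<And>x e. \<lbrakk>x \<in> M; \<not> openin mtopology {x}; 0 < e\<rbrakk> \<Longrightarrow> \<exists>A\<in>nodes. x \<in> A \<and> f A < e"
  shows "\<exists>d'. Ultrametric_space M d' \<and> Metric_space.proper_metric M d'
      \<and> Metric_space.mtopology M d' = mtopology \<and> Metric_space.dist_range M d' = R
      \<and> Metric_space.mballs M d' = mballs"
proof -
  \<comment> \<open>The value 0 outside \<open>M\<close> keeps \<open>d'\<close> nonnegative and
    symmetric everywhere, as the locale demands without membership assumptions.\<close>
  define d' where "d' = (\<lambda>x y. if x = y \<or> x \<notin> M \<or> y \<notin> M then 0 else f (node x y))"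
  have fpos: "f A > 0" if "A \<in> nodes" for A
  proof -
    have "f A \<in> R - {0}" using that R(1) by blast
    then show ?thesis using R(2) by auto
  qed
  have mono': "f A \<le> f B" if "A \<in> nodes" "B \<in> nodes" "A \<subseteq> B" for A B
    using that mono[of A B] by (cases "A = B") (simp_all add: psubset_eq)
  have d'0: "d' x y \<ge> 0" for x y
    using fpos[OF node_in_nodes] by (auto simp: d'_def less_imp_le)
  have d'pos: "d' x y > 0" if "x \<in> M" "y \<in> M" "x \<noteq> y" for x y
    using fpos[OF node_in_nodes] that by (auto simp: d'_def)
  have d'c: "d' x y = d' y x" for x y
    using node_commute[of x y] by (auto simp: d'_def)
  have leI: "d' x y \<le> d' x z" if "x \<in> M" "y \<in> M" "z \<in> M" "d x y \<le> d x z" for x y z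
  proof (cases "x = y \<or> x = z")
    case True
    then have "x = y" using that mdist_pos_less[of x y] by fastforce
    then have "d' x y = 0" by (simp add: d'_def)
    then show ?thesis using d'0 by simp
  next
    case False
    then show ?thesis
      using that mono'[of "node x y" "node x z"] node_subset_iff[of x y z] node_in_nodes
      by (simp add: d'_def)
  qed
  have lessI: "d' x y < d' x z" if "x \<in> M" "y \<in> M" "z \<in> M" "d x y < d x z" for x y z
  proof (cases "x = y")
    case True
    then show ?thesis using that d'pos by (auto simp: d'_def)
  next
    case False
    moreover have "x \<noteq> z" using that(1,4) nonneg[of x y] by (metis mdist_zero not_less)
    ultimately show ?thesis
      using that mono[of "node x y" "node x z"] node_psubset_iff[of x y z] node_in_nodes
      by (simp add: d'_def)
  qed
  have le_iff: "d' x y \<le> d' x z \<longleftrightarrow> d x y \<le> d x z" if "x \<in> M" "y \<in> M" "z \<in> M" for x y z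
    using leI[OF that] lessI[of x z y] that by force
  have ultra: "d' x y \<le> max (d' x z) (d' z y)" if "x \<in> M" "y \<in> M" "z \<in> M" for x y z
  proof (cases "d x y \<le> d x z")
    case True
    then show ?thesis using leI[of x y z] that by simp
  next
    case False
    \<comment> \<open>If \<open>d x y\<close> exceeds \<open>d x z\<close>, the ultrametric
      inequality for \<open>d\<close> makes it at most \<open>d y z\<close>. Comparing distances
      from the centre \<open>y\<close> instead then transfers to \<open>d'\<close>.\<close>
    then have "d y x \<le> d y z" using ultrametric[of x y z] that commute[of x y] commute[of y z] by auto
    then show ?thesis using leI[of y x z] that d'c[of x y] d'c[of z y] by simp
  qed
  interpret N: Ultrametric_space M d'
  proof
    fix x y z
    show "d' x y \<ge> 0" "d' x y = d' y x" by (fact d'0, fact d'c)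
    show "d' x y = 0 \<longleftrightarrow> x = y" if "x \<in> M" "y \<in> M"
      using d'pos[OF that] that by (auto simp: d'_def)
    show "d' x z \<le> d' x y + d' y z" if "x \<in> M" "y \<in> M" "z \<in> M"
      using ultra[of x z y] that d'0[of x y] d'0[of y z] by linarith
    show "d' x y \<le> max (d' x z) (d' z y)" if "x \<in> M" "y \<in> M" "z \<in> M"
      using ultra that by blast
  qed
  have top: "N.mtopology = mtopology"
  proof (rule mtopology_eqI)
    show "Metric_space M d" "Metric_space M d'" by (fact Metric_space_axioms, fact N.Metric_space_axioms)
    fix x and e :: real assume x: "x \<in> M" and e: "e > 0"
    show "\<exists>\<delta>>0. \<forall>y\<in>M. d x y < \<delta> \<longrightarrow> d' x y < e"
    proof (cases "openin mtopology {x}")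
      case True
      then obtain r where r: "r > 0" "mball x r \<subseteq> {x}" unfolding openin_mtopology by blast
      then have "d' x y < e" if "y \<in> M" "d x y < r" for y
      proof -
        have "y = x" using that r x by auto
        then show ?thesis using e by (simp add: d'_def)
      qed
      then show ?thesis using r by blast
    next
      case False
      then obtain A where A: "A \<in> nodes" "x \<in> A" "f A < e" using small x e by blast
      then obtain y where y: "y \<in> M" "y \<noteq> x" "A = node x y" using nodes_centre by metis
      then have "d' x y < e" using A x by (simp add: d'_def)
      then have "d' x z < e" if "z \<in> M" "d x z < d x y" for z
        using leI[of x z y] that x y by simp
      then show ?thesis using x y by (intro exI[of _ "d x y"]) auto
    qed
    show "\<exists>\<delta>>0. \<forall>y\<in>M. d' x y < \<delta> \<longrightarrow> d x y < e"
    proof (cases "\<exists>y\<in>M. y \<noteq> x \<and> d x y < e")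
      case True
      then obtain y where y: "y \<in> M" "y \<noteq> x" "d x y < e" by blast
      have "d x z < e" if "z \<in> M" "d' x z < d' x y" for z
        using le_iff[of x y z] that x y by (simp add: not_le[symmetric])
      then show ?thesis using d'pos[of x y] x y by blast
    next
      case False
      show ?thesis
      proof (cases "M = {x}")
        case True
        then show ?thesis using e by (auto intro!: exI[of _ 1])
      next
        case ne: False
        then obtain w where w: "w \<in> M" "w \<noteq> x" using x by blast
        \<comment> \<open>No other point is closer to \<open>x\<close> than \<open>e\<close>, so the
          minimum of this finite set is the distance to a nearest other point \<open>y\<close>. The
          \<open>d'\<close>-ball of radius \<open>d' x y\<close> around \<open>x\<close> is then
          \<open>{x}\<close>.\<close>
        let ?S = "{d x y | y. y \<in> M \<and> e \<le> d x y \<and> d x y \<le> d x w}"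
        have fin: "finite ?S" using finite_distances P x e by blast
        have "d x w \<in> ?S" using False w by force
        then obtain y where y: "y \<in> M" "e \<le> d x y" "Min ?S = d x y" "d x y \<le> d x w"
          using Min_in[OF fin] by blast
        have yx: "y \<noteq> x" using y e x by auto
        have "d x z < e" if z: "z \<in> M" "d' x z < d' x y" for z
        proof (rule ccontr)
          assume n: "\<not> d x z < e"
          have lt: "d x z < d x y" using le_iff[of x y z] z x y by (simp add: not_le[symmetric])
          then have "d x z \<in> ?S" using n z y by force
          then show False using Min_le[OF fin] y lt by fastforce
        qed
        then show ?thesis using d'pos[of x y] x y yx by blast
      qed
    qed
  qed
  have proper: "N.proper_metric"
    unfolding N.proper_metric_def
  proof (intro ballI allI)
    fix a r assume a: "a \<in> M"
    obtain A where A: "A \<in> nodes" "a \<in> A" "r < f A" using large a by blast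
    then obtain y where y: "y \<in> M" "y \<noteq> a" "A = node a y" using nodes_centre by metis
    \<comment> \<open>A node heavier than \<open>r\<close> encloses the ball. Nodes are compact, so
      the closed subset is compact too.\<close>
    have "N.mcball a r \<subseteq> A"
    proof
      fix z assume z: "z \<in> N.mcball a r"
      have "d' a y = f A" using y a by (simp add: d'_def)
      then have "d' a z \<le> d' a y" using A(3) z by simp
      then show "z \<in> A" using le_iff[of a z y] z y a by (auto simp: node_def)
    qed
    then show "compactin N.mtopology (N.mcball a r)"
      using closed_compactin nodes_compactin[OF P A(1)] N.closedin_mcball top by metis
  qed
  \<comment> \<open>A node depends only on the order of the distances from its centre, which
    \<open>d'\<close> preserves.\<close>
  have nodes': "N.node x y = node x y" if "x \<in> M" "y \<in> M" for x y
    using le_iff that by (auto simp: N.node_def node_def)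
  then have "N.nodes = nodes" unfolding N.nodes_def nodes_def by blast
  then have balls: "N.mballs = mballs"
    using N.mballs_eq_nodes_Un_singletons[OF proper] mballs_eq_nodes_Un_singletons[OF P] top by simp
  have rng: "N.dist_range = R"
  proof (intro equalityI subsetI)
    fix t assume "t \<in> N.dist_range"
    then obtain x y where "x \<in> M" "y \<in> M" "t = d' x y" unfolding N.dist_range_def by blast
    moreover have "f (node x y) \<in> R" if "x \<noteq> y"
      using R(1) node_in_nodes[of x y] calculation that by blast
    ultimately show "t \<in> R" using R(3) by (simp add: d'_def)
  next
    fix t assume t: "t \<in> R"
    show "t \<in> N.dist_range"
    proof (cases "t = 0")
      case True
      obtain x where "x \<in> M" using ne by blast
      then have "d' x x \<in> N.dist_range" unfolding N.dist_range_def by blast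
      then show ?thesis using True by (simp add: d'_def)
    next
      case False
      then obtain A where "A \<in> nodes" "t = f A" using t R(1) by blast
      then obtain x y where "x \<in> M" "y \<in> M" "x \<noteq> y" "t = f (node x y)" unfolding nodes_def by blast
      moreover from this have "d' x y = t" by (simp add: d'_def)
      ultimately show ?thesis unfolding N.dist_range_def mem_Collect_eq by metis
    qed
  qed
  show ?thesis
    using N.Ultrametric_space_axioms proper top rng balls by blast
qed

end

section \<open>Sequences and surjections into the prescribed set of values\<close>

lemma strict_mono_sequence_in_unbounded:
  fixes R :: "real set"
  assumes "R \<subseteq> {0..}" "\<not> bounded R"
  obtains \<mu> :: "nat \<Rightarrow> real" where "strict_mono \<mu>" "\<And>k. \<mu> k \<in> R" "\<And>k. real k < \<mu> k"
proof -
  have ex: "\<exists>t\<in>R. b < t" for b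
  proof (rule ccontr)
    assume "\<not> ?thesis"
    then have "R \<subseteq> {0..b}" using assms(1) by force
    then show False using assms(2) bounded_closed_interval bounded_subset by blast
  qed
  have "\<exists>\<mu>. \<forall>k. (\<mu> k \<in> R \<and> real k < \<mu> k) \<and> \<mu> k < \<mu> (Suc k)"
  proof (rule dependent_nat_choice)
    show "\<exists>t. t \<in> R \<and> real 0 < t" using ex by blast
    fix t :: real and k
    show "\<exists>u. (u \<in> R \<and> real (Suc k) < u) \<and> t < u"
      using ex[of "max (real (Suc k)) t"] by auto
  qed
  then show thesis using that strict_mono_Suc_iff by metis
qed

lemma decreasing_sequence_in_limit:
  fixes R :: "real set"
  assumes "R \<subseteq> {0..}" "0 islimpt R"
  obtains \<nu> :: "nat \<Rightarrow> real" where "\<And>i j. i < j \<Longrightarrow> \<nu> j < \<nu> i" "\<And>k. \<nu> k \<in> R - {0}"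
    "\<And>k. \<nu> k < 1 / real (Suc k)"
proof -
  have ex: "\<exists>t\<in>R - {0}. t < e" if e: "e > 0" for e
  proof -
    obtain t where "t \<in> R" "t \<noteq> 0" "dist t 0 < e"
      using assms(2) e unfolding islimpt_approachable by metis
    then show ?thesis by (auto intro!: bexI[of _ t])
  qed
  have "\<exists>\<nu>. \<forall>k. (\<nu> k \<in> R - {0} \<and> \<nu> k < 1 / real (Suc k)) \<and> \<nu> (Suc k) < \<nu> k"
  proof (rule dependent_nat_choice)
    show "\<exists>t. t \<in> R - {0} \<and> t < 1 / real (Suc 0)" using ex[of 1] by auto
    fix t :: real and k
    assume "t \<in> R - {0} \<and> t < 1 / real (Suc k)"
    then have "t > 0" using assms(1) by auto
    then obtain u where "u \<in> R - {0}" "u < min t (1 / real (Suc (Suc k)))"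
      using ex[of "min t (1 / real (Suc (Suc k)))"] by auto
    then show "\<exists>u. (u \<in> R - {0} \<and> u < 1 / real (Suc (Suc k))) \<and> u < t" by auto
  qed
  then obtain \<nu> where \<nu>: "\<And>k. \<nu> k \<in> R - {0}" "\<And>k. \<nu> k < 1 / real (Suc k)"
    "\<And>k. \<nu> (Suc k) < \<nu> k" by metis
  have "strict_mono (\<lambda>k. - \<nu> k)" using \<nu>(3) by (simp add: strict_mono_Suc_iff)
  then have "\<nu> j < \<nu> i" if "i < j" for i j
    using strict_monoD[of "\<lambda>k. - \<nu> k", OF _ that] by simp
  then show thesis using that \<nu> by blast
qed

lemma infinite_surj_countable:
  assumes "infinite A" "countable B" "B \<noteq> {}"
  obtains m where "m ` A = B"
proof -
  obtain g :: "nat \<Rightarrow> 'a" where g: "inj g" "range g \<subseteq> A"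
    using infinite_countable_subset[OF assms(1)] by blast
  \<comment> \<open>Outside the range of \<open>g\<close> the inverse is an unspecified number, but
    every value of \<open>from_nat_into B\<close> still lies in \<open>B\<close>.\<close>
  define m where "m = (\<lambda>a. from_nat_into B (inv g a))"
  have "m ` A \<subseteq> B" using from_nat_into[OF assms(3)] by (auto simp: m_def)
  moreover have "B \<subseteq> m ` A"
  proof
    fix b assume "b \<in> B"
    then obtain k where "b = from_nat_into B k" 
      using range_from_nat_into[OF assms(3,2)] by (metis rangeE)
    then have "b = m (g k)" using g(1) by (simp add: m_def)
    then show "b \<in> m ` A" using g(2) by blast
  qed
  ultimately show thesis using that by blast
qed

section \<open>Construction of the weight from a partition into balls\<close>

context Ultrametric_space
begin

text \<open>By nesting, a node is a cell, lies strictly inside one cell, or contains every cell it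
  meets. The three kinds get their weights from a surjection \<open>m\<close>, from a null sequence
  \<open>\<nu>\<close> indexed by depth, and from an unbounded sequence \<open>\<mu>\<close> indexed
  by a sum over the cells contained. The assumption \<open>low\<close> asks for values near 0 only
  if nodes of the second kind occur; the conclusions are the hypotheses of
  \<open>remetrize\<close>.\<close>

lemma node_weight_exists:
  assumes P: proper_metric and nc: "\<not> compact_space mtopology"
    and part: "partition_on M \<P>" and balls: "\<P> \<subseteq> mballs"
    and inf: "infinite {Q \<in> \<P>. \<not> is_singleton Q}"
    and R: "R \<subseteq> {0..}" "countable R" "\<not> bounded R"
    and low: "\<And>Q A. \<lbrakk>Q \<in> \<P>; A \<in> nodes; A \<subset> Q\<rbrakk> \<Longrightarrow> (0::real) islimpt R"
  obtains f where "\<And>A B. \<lbrakk>A \<in> nodes; B \<in> nodes; A \<subset> B\<rbrakk> \<Longrightarrow> f A < f B"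
    and "f ` nodes = R - {0}"
    and "\<And>x r. x \<in> M \<Longrightarrow> \<exists>A\<in>nodes. x \<in> A \<and> r < f A"
    and "\<And>x e. \<lbrakk>x \<in> M; \<not> openin mtopology {x}; 0 < e\<rbrakk> \<Longrightarrow> \<exists>A\<in>nodes. x \<in> A \<and> f A < e"
proof -
  have nsing: "\<not> is_singleton A" if "A \<in> nodes" for A
    using nodes_two_points[OF that] by (metis is_singleton_def singletonD)
  have Qcases: "Q \<in> nodes \<or> (\<exists>a. Q = {a} \<and> openin mtopology {a})" if "Q \<in> \<P>" for Q
    using balls that unfolding mballs_eq_nodes_Un_singletons[OF P] by blast
  have Qopen: "openin mtopology Q" if "Q \<in> \<P>" for Q
    using Qcases[OF that] nodes_openin by blast
  have N': "{Q \<in> \<P>. \<not> is_singleton Q} = \<P> \<inter> nodes"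
    using Qcases nsing by (auto simp: is_singleton_def)
  have disj: "Q = Q'" if "Q \<in> \<P>" "Q' \<in> \<P>" "Q \<inter> Q' \<noteq> {}" for Q Q'
    using part that by (metis disjointD partition_onD2)
  have Qne: "Q \<noteq> {}" if "Q \<in> \<P>" for Q using partition_onD3[OF part] that by blast
  have Qex: "\<exists>Q\<in>\<P>. x \<in> Q" if "x \<in> M" for x using partition_onD1[OF part] that by blast
  have Ane: "A \<noteq> {}" if "A \<in> nodes" for A using nodes_two_points[OF that] by blast
  have nested: "A \<subseteq> Q \<or> Q \<subseteq> A" if "A \<in> nodes" "Q \<in> \<P>" "A \<inter> Q \<noteq> {}" for A Q
    using Qcases[OF that(2)] nodes_nested[OF that(1)] that(3) by blast
  have "R - {0} \<noteq> {}" using R(3) by (metis Diff_eq_empty_iff bounded_insert bounded_empty bounded_subset)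
  \<comment> \<open>Distinct cells are disjoint, hence incomparable, so any surjection is compatible
    with monotonicity.\<close>
  then obtain m where m: "m ` (\<P> \<inter> nodes) = R - {0}"
    using infinite_surj_countable[of "\<P> \<inter> nodes" "R - {0}"] inf R(2) unfolding N' by auto
  have mpos: "m Q > 0" if "Q \<in> \<P>" "Q \<in> nodes" for Q
  proof -
    have "m Q \<in> R - {0}" using m that by blast
    then show ?thesis using R(1) by auto
  qed
  obtain \<mu> :: "nat \<Rightarrow> real" where mu: "strict_mono \<mu>" "\<And>k. \<mu> k \<in> R" "\<And>k. real k < \<mu> k"
    using strict_mono_sequence_in_unbounded R(1,3) by metis
  \<comment> \<open>The implication is inside the quantifier so that \<open>\<nu>\<close> exists in
    every case; its properties become available through \<open>low\<close> whenever some node lies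
    strictly inside a cell.\<close>
  have "\<exists>\<nu>::nat \<Rightarrow> real. 0 islimpt R \<longrightarrow>
      (\<forall>i j. i < j \<longrightarrow> \<nu> j < \<nu> i) \<and> (\<forall>k. \<nu> k \<in> R - {0}) \<and> (\<forall>k. \<nu> k < 1 / real (Suc k))"
    using decreasing_sequence_in_limit[OF R(1)] by metis
  then obtain \<nu> :: "nat \<Rightarrow> real" where nu: "0 islimpt R \<Longrightarrow> i < j \<Longrightarrow> \<nu> j < \<nu> i"
    "0 islimpt R \<Longrightarrow> \<nu> k \<in> R - {0}" "0 islimpt R \<Longrightarrow> \<nu> k < 1 / real (Suc k)" for i j k
    by blast
  \<comment> \<open>\<open>g Q\<close> bounds \<open>m Q\<close> from above, so the sum over the
    cells in a node dominates each of their weights; it is also positive, so the sum grows strictly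
    with each new cell.\<close>
  define g where "g Q = Suc (nat \<lceil>m Q\<rceil>)" for Q
  define cell where "cell A = (THE Q. Q \<in> \<P> \<and> A \<subseteq> Q)" for A
  define sub where "sub A = {Q \<in> \<P>. Q \<subseteq> A}" for A
  define depth where "depth A = card {B \<in> nodes. A \<subset> B \<and> B \<subseteq> cell A}" for A
  \<comment> \<open>Since \<open>\<nu> k < 1 / (k + 1)\<close>, the offset by the ceiling of
    \<open>1 / m (cell A)\<close> pushes the weight below that of the surrounding cell.\<close>
  define f where "f A = (if A \<in> \<P> then m A
      else if \<exists>Q\<in>\<P>. A \<subset> Q then \<nu> (nat \<lceil>1 / m (cell A)\<rceil> + depth A)
      else \<mu> (sum g (sub A)))" for A
  have cell: "cell A = Q" if "A \<in> nodes" "Q \<in> \<P>" "A \<subseteq> Q" for A Q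
    unfolding cell_def
  proof (rule the_equality)
    show "Q' = Q" if "Q' \<in> \<P> \<and> A \<subseteq> Q'" for Q'
      using disj[of Q' Q] that \<open>A \<in> nodes\<close> \<open>Q \<in> \<P>\<close> \<open>A \<subseteq> Q\<close> Ane by blast
  qed (use that in simp)
  have Qnode: "Q \<in> nodes" if "Q \<in> \<P>" "A \<in> nodes" "A \<subset> Q" for A Q
    using Qcases[OF that(1)] that Ane[OF that(2)] by blast
  have notin: "A \<notin> \<P>" if "Q \<in> \<P>" "A \<in> nodes" "A \<subset> Q" for A Q
    using disj[of A Q] that Ane[OF that(2)] by blast
  have f_low: "f A = \<nu> (nat \<lceil>1 / m Q\<rceil> + depth A)" if "Q \<in> \<P>" "A \<in> nodes" "A \<subset> Q" for A Q
  proof -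
    have "cell A = Q" using cell that by blast
    moreover have "\<exists>Q\<in>\<P>. A \<subset> Q" using that by blast
    ultimately show ?thesis using notin[OF that] by (simp add: f_def)
  qed
  have f_low_less: "f A < 1 / real (Suc (depth A))" "f A < m Q"
    if A: "Q \<in> \<P>" "A \<in> nodes" "A \<subset> Q" for A Q
  proof -
    let ?k = "nat \<lceil>1 / m Q\<rceil> + depth A"
    have f: "f A < 1 / real (Suc ?k)" 
      unfolding f_low[OF A] by (rule nu(3)[OF low[OF A]])
    also have "\<dots> \<le> 1 / real (Suc (depth A))" by (simp add: frac_le)
    finally show "f A < 1 / real (Suc (depth A))" .
    have pos: "m Q > 0" using mpos Qnode A by blast
    have "1 / m Q \<le> real (Suc ?k)" by linarith
    then have "1 / real (Suc ?k) \<le> m Q"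
      using le_imp_inverse_le[of "1 / m Q" "real (Suc ?k)"] pos by (simp add: inverse_eq_divide)
    then show "f A < m Q" using f by linarith
  qed
  have depth_less: "depth B < depth A"
    if "Q \<in> \<P>" "A \<in> nodes" "B \<in> nodes" "A \<subset> B" "B \<subset> Q" for A B Q
  proof -
    have c: "cell A = Q" "cell B = Q" using cell that by blast+
    have "Q \<in> nodes" using Qnode that by blast
    then have "finite {B \<in> nodes. A \<subseteq> B \<and> B \<subseteq> Q}" using finite_nodes_between P that by blast
    then have "finite {B \<in> nodes. A \<subset> B \<and> B \<subseteq> Q}" by (rule rev_finite_subset) blast
    then show ?thesis unfolding depth_def c
      \<comment> \<open>The node \<open>B\<close> itself is counted for \<open>A\<close> but not for
        \<open>B\<close>.\<close>
      by (rule psubset_card_mono) (use that in blast)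
  qed
  have fin: "finite (sub A)" if "A \<in> nodes" for A
  proof -
    have "finite {Q \<in> \<P>. Q \<inter> A \<noteq> {}}"
      by (rule finite_disjoint_open_meeting_compact[OF nodes_compactin[OF P that] Qopen])
        (use nodes_subset[OF that] part in \<open>auto simp: partition_on_def\<close>)
    then show ?thesis
      by (rule rev_finite_subset) (use Qne in \<open>auto simp: sub_def\<close>)
  qed
  have f_upper: "f A = \<mu> (sum g (sub A))" if "\<not> (\<exists>Q\<in>\<P>. A \<subseteq> Q)" for A
    using that by (auto simp: f_def)
  \<comment> \<open>A node contained in no cell swallows each cell that it meets.\<close>
  have upper: "Q \<in> sub A" if "A \<in> nodes" "\<not> (\<exists>Q\<in>\<P>. A \<subseteq> Q)" "Q \<in> \<P>" "A \<inter> Q \<noteq> {}" for A Q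
    using nested[OF that(1,3,4)] that(2,3) by (auto simp: sub_def)
  have m_less: "m Q < \<mu> (sum g (sub A))" if "A \<in> nodes" "Q \<in> sub A" for A Q
  proof -
    have "m Q \<le> real (g Q)" unfolding g_def by linarith
    also have "\<dots> \<le> real (sum g (sub A))" 
      using that fin by (intro of_nat_mono member_le_sum) auto
    also have "\<dots> < \<mu> (sum g (sub A))" by (rule mu(3))
    finally show ?thesis .
  qed
  have mono: "f A < f B" if AB: "A \<in> nodes" "B \<in> nodes" "A \<subset> B" for A B
  proof -
    consider "B \<in> \<P>" | Q where "Q \<in> \<P>" "B \<subset> Q" | "\<not> (\<exists>Q\<in>\<P>. B \<subseteq> Q)" by blast
    then show ?thesis
    proof cases
      case 1
      then show ?thesis using f_low_less(2)[OF 1] AB by (simp add: f_def)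
    next
      case 2
      then have A: "A \<subset> Q" using AB by blast
      show ?thesis
        unfolding f_low[OF 2(1) AB(1) A] f_low[OF 2(1) AB(2) 2(2)]
        using nu(1)[OF low[OF 2(1) AB(1) A]] depth_less[OF 2(1) AB 2(2)] by simp
    next
      case 3
      consider Q where "Q \<in> \<P>" "A \<subseteq> Q" | "\<not> (\<exists>Q\<in>\<P>. A \<subseteq> Q)" by blast
      then show ?thesis
      proof cases
        case 1
        have "B \<inter> Q \<noteq> {}" using 1 AB Ane by blast
        then have Q: "Q \<in> sub B" using upper[OF AB(2) 3 1(1)] by blast
        have "f A \<le> m Q"
        proof (cases "A = Q")
          case True
          then show ?thesis using 1 by (simp add: f_def)
        next
          case False
          then have "A \<subset> Q" using 1 by (simp add: psubset_eq)
          then show ?thesis using f_low_less(2)[OF 1(1) AB(1)] by simp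
        qed
        then show ?thesis using m_less[OF AB(2) Q] f_upper[OF 3] by simp
      next
        case 2
        \<comment> \<open>The cell of a point of \<open>B\<close> outside \<open>A\<close> is
          contained in \<open>B\<close> but not in \<open>A\<close>, so the sum, and with it the
          index of \<open>\<mu>\<close>, increases strictly.\<close>
        obtain x where x: "x \<in> B" "x \<notin> A" using AB by blast
        then obtain Q where Q: "Q \<in> \<P>" "x \<in> Q" using Qex nodes_subset AB by blast
        have "Q \<in> sub B" using upper[OF AB(2) 3 Q(1)] x Q by blast
        moreover have "Q \<notin> sub A" using x Q by (auto simp: sub_def)
        moreover have "sub A \<subseteq> sub B" using AB by (auto simp: sub_def)
        ultimately have "sum g (sub A) < sum g (sub B)"
          using fin[OF AB(2)] by (intro sum_strict_mono2[of _ _ Q]) (auto simp: g_def)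
        then show ?thesis
          unfolding f_upper[OF 2] f_upper[OF 3] using mu(1) by (simp add: strict_mono_less)
      qed
    qed
  qed
  have fR: "f A \<in> R - {0}" if A: "A \<in> nodes" for A
  proof -
    consider "A \<in> \<P>" | Q where "Q \<in> \<P>" "A \<subset> Q" | "\<not> (\<exists>Q\<in>\<P>. A \<subseteq> Q)" by blast
    then show ?thesis
    proof cases
      case 1
      then have "f A = m A" by (simp add: f_def)
      then show ?thesis using m 1 A by blast
    next
      case 2
      then show ?thesis using f_low[OF 2(1) A 2(2)] nu(2)[OF low[OF 2(1) A 2(2)]] by simp
    next
      case 3
      have "\<mu> (sum g (sub A)) > 0" using mu(3) of_nat_0_le_iff le_less_trans by blast
      then show ?thesis using f_upper[OF 3] mu(2) by simp
    qed
  qed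
  have "R - {0} \<subseteq> f ` nodes"
  proof
    fix t assume "t \<in> R - {0}"
    then obtain Q where "Q \<in> \<P>" "Q \<in> nodes" "t = m Q" using m by blast
    then have "t = f Q" "Q \<in> nodes" by (simp_all add: f_def)
    then show "t \<in> f ` nodes" by (rule image_eqI)
  qed
  then have rng: "f ` nodes = R - {0}" by (intro subset_antisym image_subsetI fR)
  have large: "\<exists>A\<in>nodes. x \<in> A \<and> r < f A" if x: "x \<in> M" for x r
  proof -
    have "infinite \<P>" using inf by (rule contrapos_nn) simp
    \<comment> \<open>A node around \<open>x\<close> reaching beyond one chosen point of each cell
      in \<open>F\<close> meets all these cells. Having at least two of them rules out that it lies
      in a single cell; having at least \<open>r\<close> of them makes the sum of \<open>g\<close>
      at least \<open>r\<close>.\<close>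
    then obtain F where F: "finite F" "card F = nat \<lceil>r\<rceil> + 2" "F \<subseteq> \<P>"
      using infinite_arbitrarily_large by blast
    define p where "p Q = (SOME y. y \<in> Q)" for Q :: "'a set"
    have p: "p Q \<in> Q" if "Q \<in> F" for Q
      unfolding p_def some_in_eq using Qne F(3) that by auto
    have pM: "p Q \<in> M" if "Q \<in> F" for Q
      using p[OF that] F that partition_onD1[OF part] by blast
    define D where "D = Max (insert 0 ((\<lambda>Q. d x (p Q)) ` F))"
    have D: "d x (p Q) \<le> D" if "Q \<in> F" for Q
      unfolding D_def using F that by (intro Max_ge) auto
    have "0 \<le> D" unfolding D_def using F by (intro Max_ge) auto
    obtain y where y: "y \<in> M" "D < d x y" using unbounded_distances[OF P nc x] by blast
    then have "x \<noteq> y" using \<open>0 \<le> D\<close> x by auto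
    define A where "A = node x y"
    have A: "A \<in> nodes" "x \<in> A"
      using node_in_nodes in_node x y \<open>x \<noteq> y\<close> by (auto simp: A_def)
    have pA: "p Q \<in> A" if "Q \<in> F" for Q
      using D[OF that] pM[OF that] y x by (auto simp: A_def node_def)
    have up: "\<not> (\<exists>Q\<in>\<P>. A \<subseteq> Q)"
    proof
      assume "\<exists>Q\<in>\<P>. A \<subseteq> Q"
      then obtain Q where Q: "Q \<in> \<P>" "A \<subseteq> Q" by blast
      have "F \<subseteq> {Q}"
      proof
        fix Q' assume "Q' \<in> F"
        then have "p Q' \<in> Q \<inter> Q'" "Q' \<in> \<P>" using pA p Q F by auto
        then show "Q' \<in> {Q}" using disj Q by blast
      qed
      then have "card F \<le> card {Q}" by (intro card_mono) auto
      then show False using F by simp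
    qed
    have "F \<subseteq> sub A" using upper[OF A(1) up] p pA F by blast
    then have "card F \<le> card (sub A)" using fin A card_mono by blast
    also have "\<dots> = sum (\<lambda>_. 1) (sub A)" by simp
    also have "\<dots> \<le> sum g (sub A)" by (rule sum_mono) (simp add: g_def)
    finally have "r \<le> real (sum g (sub A))" using F by linarith
    then have "r < f A" unfolding f_upper[OF up] using mu(3) le_less_trans by blast
    then show ?thesis using A by blast
  qed
  have small: "\<exists>A\<in>nodes. x \<in> A \<and> f A < e"
    if x: "x \<in> M" "\<not> openin mtopology {x}" and e: "0 < e" for x e
  proof -
    obtain Q where Q: "Q \<in> \<P>" "x \<in> Q" using Qex x by blast
    then have "Q \<in> nodes" using Qcases x by fastforce
    \<comment> \<open>At a non-isolated point one can descend through nodes without end, each step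
      raising the depth; the weight is below \<open>1 / (depth + 1)\<close>.\<close>
    have "\<exists>A\<in>nodes. x \<in> A \<and> A \<subset> Q \<and> k \<le> depth A" for k
    proof (induction k)
      case 0
      obtain B where "B \<in> nodes" "x \<in> B" "B \<subset> Q"
        by (rule smaller_node[OF x(2) \<open>Q \<in> nodes\<close> Q(2)])
      then show ?case by blast
    next
      case (Suc k)
      then obtain A where A: "A \<in> nodes" "x \<in> A" "A \<subset> Q" "k \<le> depth A" by blast
      obtain B where B: "B \<in> nodes" "x \<in> B" "B \<subset> A"
        by (rule smaller_node[OF x(2) A(1,2)])
      then have "Suc k \<le> depth B" using depth_less[OF Q(1) B(1) A(1) B(3) A(3)] A by simp
      then show ?case using A B by blast
    qed
    then obtain A where A: "A \<in> nodes" "x \<in> A" "A \<subset> Q" "nat \<lceil>1 / e\<rceil> \<le> depth A" by blast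
    have "1 / e \<le> real (Suc (depth A))" using A(4) by linarith
    then have "1 / real (Suc (depth A)) \<le> e"
      using le_imp_inverse_le[of "1 / e" "real (Suc (depth A))"] e by (simp add: inverse_eq_divide)
    then show ?thesis using f_low_less(1)[OF Q(1) A(1,3)] A by force
  qed
  show thesis using that[of f] mono rng large small by blast
qed

section \<open>Discrete spaces, and the choice of a suitable partition\<close>

text \<open>A compact set of isolated points is finite, so only finitely many nodes lie inside
  \<open>A\<close>.\<close>

lemma minimal_node_exists:
  assumes P: proper_metric and iso: "\<And>x. x \<in> M \<Longrightarrow> openin mtopology {x}" and A: "A \<in> nodes"
  obtains B where "B \<in> nodes" "B \<subseteq> A" "\<And>C. C \<in> nodes \<Longrightarrow> \<not> C \<subset> B"
proof -
  have AM: "A \<subseteq> M" by (rule nodes_subset[OF A])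
  have "finite {U \<in> (\<lambda>x. {x}) ` M. U \<inter> A \<noteq> {}}"
    by (rule finite_disjoint_open_meeting_compact[OF nodes_compactin[OF P A]])
      (use iso AM in \<open>auto simp: disjoint_def\<close>)
  moreover have "(\<lambda>x. {x}) ` A \<subseteq> {U \<in> (\<lambda>x. {x}) ` M. U \<inter> A \<noteq> {}}" using AM by auto
  ultimately have "finite ((\<lambda>x. {x}) ` A)" by (rule rev_finite_subset)
  then have "finite A" by (rule finite_imageD) (simp add: inj_on_def)
  then have "finite {B \<in> nodes. B \<subseteq> A}" by (intro finite_subset[OF _ finite_Pow_iff[THEN iffD2]]) auto
  moreover have "{B \<in> nodes. B \<subseteq> A} \<noteq> {}" using A by blast
  ultimately have "\<exists>B\<in>{B \<in> nodes. B \<subseteq> A}. \<not> (\<exists>C\<in>{B \<in> nodes. B \<subseteq> A}. C < B)"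
    by (rule ex_min_if_finite)
  then obtain B where B: "B \<in> nodes" "B \<subseteq> A" "\<not> (\<exists>C\<in>{B \<in> nodes. B \<subseteq> A}. C < B)" by blast
  have "\<not> C \<subset> B" if "C \<in> nodes" for C using B that by auto
  then show thesis using that B(1,2) by blast
qed

text \<open>In a discrete space a partition into balls is refined to one whose non-singletons are minimal
  nodes, so that no weights close to 0 are needed.\<close>

lemma refine_to_minimal_nodes:
  assumes P: proper_metric and iso: "\<And>x. x \<in> M \<Longrightarrow> openin mtopology {x}"
    and part: "partition_on M \<P>" and balls: "\<P> \<subseteq> mballs"
    and inf: "infinite {Q \<in> \<P>. \<not> is_singleton Q}"
  obtains \<Q> where "partition_on M \<Q>" "\<Q> \<subseteq> mballs" "infinite {Q \<in> \<Q>. \<not> is_singleton Q}"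
    "\<And>Q A. \<lbrakk>Q \<in> \<Q>; A \<in> nodes\<rbrakk> \<Longrightarrow> \<not> A \<subset> Q"
proof -
  have nsing: "\<not> is_singleton A" if A: "A \<in> nodes" for A
  proof -
    obtain x y where "x \<in> A" "y \<in> A" "x \<noteq> y" by (rule nodes_two_points[OF A])
    then show ?thesis by (auto simp: is_singleton_def)
  qed
  have Ane: "A \<noteq> {}" if A: "A \<in> nodes" for A
    by (rule nodes_two_points[OF A]) blast
  define S where "S = {Q \<in> \<P>. \<not> is_singleton Q}"
  have Snode: "Q \<in> nodes" if "Q \<in> S" for Q
    using balls that unfolding S_def mballs_eq_nodes_Un_singletons[OF P] by (auto simp: is_singleton_def)
  have "\<exists>B. B \<in> nodes \<and> B \<subseteq> Q \<and> (\<forall>C\<in>nodes. \<not> C \<subset> B)" if "Q \<in> S" for Q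
    using minimal_node_exists[OF P iso Snode[OF that]] by metis
  then obtain c where c: "\<And>Q. Q \<in> S \<Longrightarrow> c Q \<in> nodes" "\<And>Q. Q \<in> S \<Longrightarrow> c Q \<subseteq> Q"
    "\<And>Q C. Q \<in> S \<Longrightarrow> C \<in> nodes \<Longrightarrow> \<not> C \<subset> c Q" by metis
  have disjS: "Q = Q'" if "Q \<in> S" "Q' \<in> S" "c Q \<inter> c Q' \<noteq> {}" for Q Q'
  proof (rule ccontr)
    assume "Q \<noteq> Q'"
    then have "Q \<inter> Q' = {}"
      using disjointD[OF partition_onD2[OF part]] that unfolding S_def by blast
    then show False using c(2)[OF that(1)] c(2)[OF that(2)] that(3) by blast
  qed
  \<comment> \<open>Points not covered by the chosen minimal nodes become singleton cells, which are
    balls because every point is isolated.\<close>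
  define \<Q> where "\<Q> = c ` S \<union> (\<lambda>x. {x}) ` (M - \<Union> (c ` S))"
  have "partition_on M \<Q>"
  proof (rule partition_onI)
    show "\<Union>\<Q> = M"
      using nodes_subset[OF c(1)] by (auto simp: \<Q>_def)
    show "disjnt A B" if "A \<in> \<Q>" "B \<in> \<Q>" "A \<noteq> B" for A B
      using that disjS by (auto simp: \<Q>_def disjnt_def)
    show "{} \<notin> \<Q>"
      using Ane[OF c(1)] by (force simp: \<Q>_def)
  qed
  moreover have "\<Q> \<subseteq> mballs"
    unfolding mballs_eq_nodes_Un_singletons[OF P] \<Q>_def using c(1) iso by auto
  moreover have "infinite {Q \<in> \<Q>. \<not> is_singleton Q}"
  proof
    assume "finite {Q \<in> \<Q>. \<not> is_singleton Q}"
    then have "finite (c ` S)"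
      by (rule rev_finite_subset) (use nsing c(1) in \<open>auto simp: \<Q>_def\<close>)
    \<comment> \<open>The chosen nodes are nonempty and lie in disjoint cells, so none is lost and
      infinitely many remain.\<close>
    moreover have "inj_on c S"
    proof (rule inj_onI)
      fix Q Q' assume "Q \<in> S" "Q' \<in> S" "c Q = c Q'"
      then show "Q = Q'" using disjS[of Q Q'] Ane[OF c(1)[of Q]] by simp
    qed
    ultimately have "finite S" by (rule finite_imageD)
    then show False using inf by (simp add: S_def)
  qed
  moreover have "\<not> A \<subset> Q" if Q: "Q \<in> \<Q>" and A: "A \<in> nodes" for Q A
  proof -
    consider R where "R \<in> S" "Q = c R" | x where "Q = {x}" using Q by (auto simp: \<Q>_def)
    then show ?thesis
    proof cases
      case 1
      then show ?thesis using c(3) A by blast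
    next
      case 2
      then show ?thesis using Ane[OF A] by blast
    qed
  qed
  ultimately show thesis by (rule that)
qed

text \<open>If 0 is a limit point of \<open>R\<close>, the given partition serves. Otherwise
  \<open>lim\<close> makes the space discrete, and the partition is refined until no node lies
  strictly inside a cell.\<close>

lemma remetrize_with_range:
  assumes P: proper_metric and nc: "\<not> compact_space mtopology"
    and part: "partition_on M \<P>" and balls: "\<P> \<subseteq> mballs"
    and inf: "infinite {Q \<in> \<P>. \<not> is_singleton Q}"
    and R: "R \<subseteq> {0..}" "countable R" "\<not> bounded R" "0 \<in> R"
    and lim: "(\<exists>x\<in>M. \<not> openin mtopology {x}) \<longrightarrow> (0::real) islimpt R"
  shows "\<exists>d'. Ultrametric_space M d' \<and> Metric_space.proper_metric M d'
      \<and> Metric_space.mtopology M d' = mtopology \<and> Metric_space.dist_range M d' = R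
      \<and> Metric_space.mballs M d' = mballs"
proof -
  obtain \<Q> where Q: "partition_on M \<Q>" "\<Q> \<subseteq> mballs" "infinite {Q \<in> \<Q>. \<not> is_singleton Q}"
    and low: "\<And>Q A. \<lbrakk>Q \<in> \<Q>; A \<in> nodes; A \<subset> Q\<rbrakk> \<Longrightarrow> 0 islimpt R"
  proof (cases "0 islimpt R")
    case True
    then show thesis using that[OF part balls inf] by blast
  next
    case False
    then have iso: "openin mtopology {x}" if "x \<in> M" for x using lim that by blast
    obtain \<Q> where Q: "partition_on M \<Q>" "\<Q> \<subseteq> mballs" "infinite {Q \<in> \<Q>. \<not> is_singleton Q}"
      "\<And>Q A. \<lbrakk>Q \<in> \<Q>; A \<in> nodes\<rbrakk> \<Longrightarrow> \<not> A \<subset> Q"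
      using refine_to_minimal_nodes[OF P iso part balls inf] by metis
    show thesis by (rule that[OF Q(1-3)]) (use Q(4) in blast)
  qed
  have ne: "M \<noteq> {}" using nc by (auto simp: compact_space_def)
  show ?thesis
  proof (rule node_weight_exists[OF P nc Q R(1-3)])
    show "0 islimpt R" if "Q \<in> \<Q>" "A \<in> nodes" "A \<subset> Q" for Q A by (rule low[OF that])
    fix f :: "'a set \<Rightarrow> real"
    assume f: "\<And>A B. \<lbrakk>A \<in> nodes; B \<in> nodes; A \<subset> B\<rbrakk> \<Longrightarrow> f A < f B"
      "f ` nodes = R - {0}"
      "\<And>x r. x \<in> M \<Longrightarrow> \<exists>A\<in>nodes. x \<in> A \<and> r < f A"
      "\<And>x e. \<lbrakk>x \<in> M; \<not> openin mtopology {x}; 0 < e\<rbrakk> \<Longrightarrow> \<exists>A\<in>nodes. x \<in> A \<and> f A < e"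
    show ?thesis by (rule remetrize[OF P ne f(1,2) R(1,4) f(3,4)])
  qed
qed

section \<open>Compact open exhaustion and a proper ultrametric\<close>

text \<open>The cover consists of the compact balls among those of radius \<open>1 / (n + 1)\<close>
  around points of a countable dense set. Balls are clopen, so a ball inside a compact neighbourhood
  is itself compact.\<close>

lemma countable_compact_open_cover:
  assumes lc: "locally_compact_space mtopology" and sep: "separable_space mtopology"
  obtains \<W> where "countable \<W>" "\<And>W. W \<in> \<W> \<Longrightarrow> openin mtopology W \<and> compactin mtopology W"
    "\<Union>\<W> = M"
proof -
  obtain C where C: "countable C" "C \<subseteq> M" "mtopology closure_of C = M"
    using sep unfolding separable_space_def by auto
  let ?I = "{pn \<in> C \<times> (UNIV::nat set). compactin mtopology (mball (fst pn) (1 / Suc (snd pn)))}"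
  define \<W> where "\<W> = (\<lambda>pn. mball (fst pn) (1 / Suc (snd pn))) ` ?I"
  have "countable (C \<times> (UNIV::nat set))" using C(1) by simp
  then have "countable \<W>" unfolding \<W>_def by (intro countable_image) (rule countable_subset[rotated], auto)
  moreover have WW: "openin mtopology W \<and> compactin mtopology W" if "W \<in> \<W>" for W
    using that by (auto simp: \<W>_def)
  moreover have "\<Union>\<W> = M"
  proof (rule subset_antisym)
    show "\<Union>\<W> \<subseteq> M" by (auto simp: \<W>_def)
    show "M \<subseteq> \<Union>\<W>"
    proof
      fix x assume x: "x \<in> M"
      then obtain U K where K: "openin mtopology U" "compactin mtopology K" "x \<in> U" "U \<subseteq> K"
        using lc unfolding locally_compact_space_def by (metis topspace_mtopology)
      then obtain r where r: "r > 0" "mball x r \<subseteq> U" unfolding openin_mtopology by blast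
      obtain n where n: "1 / real (Suc n) < r" using nat_approx_posE[OF r(1)] by blast
      define s where "s = 1 / real (Suc n)"
      have s: "s > 0" "s < r" using n by (auto simp: s_def)
      have "x \<in> mtopology closure_of C" using C x by simp
      then obtain p where p: "p \<in> C" "p \<in> mball x s" using s(1) by (auto simp: metric_closure_of)
      \<comment> \<open>Moving the centre to the nearby dense point \<open>p\<close> costs no radius
        in an ultrametric space.\<close>
      have sub: "mball p s \<subseteq> mball x s"
      proof
        fix z assume z: "z \<in> mball p s"
        then show "z \<in> mball x s" using p ultrametric[of x z p] by auto
      qed
      then have "mball p s \<subseteq> K" using mball_subset_concentric[of s r x] r s K by fastforce
      then have "compactin mtopology (mball p s)"
        using closed_compactin[OF K(2) _ closedin_mball] by blast
      then have "mball p s \<in> \<W>" using p(1) unfolding \<W>_def s_def by (intro image_eqI[of _ _ "(p, n)"]) auto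
      moreover have "x \<in> mball p s" using p by (simp add: commute)
      ultimately show "x \<in> \<Union>\<W>" by blast
    qed
  qed
  ultimately show thesis by (rule that)
qed

text \<open>Each stage adds the next member of a countable compact open cover and two members
  containing new points. The two new points ensure that the successive differences are not
  singletons.\<close>

lemma compact_open_exhaustion:
  assumes lc: "locally_compact_space mtopology" and sep: "separable_space mtopology"
    and nc: "\<not> compact_space mtopology"
  obtains V :: "nat \<Rightarrow> 'a set" where "\<And>n. openin mtopology (V n)" "\<And>n. compactin mtopology (V n)"
    "\<And>n. V n \<subseteq> V (Suc n)" "\<And>x. x \<in> M \<Longrightarrow> \<exists>n. x \<in> V n"
    "\<And>n. \<exists>x y. x \<noteq> y \<and> {x, y} \<subseteq> V (Suc n) - V n"
proof -
  obtain \<W> where W: "countable \<W>" "\<And>W. W \<in> \<W> \<Longrightarrow> openin mtopology W \<and> compactin mtopology W"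
    "\<Union>\<W> = M" using countable_compact_open_cover[OF lc sep] by blast
  have "M \<noteq> {}" using nc by (auto simp: compact_space_def)
  then have Wne: "\<W> \<noteq> {}" using W(3) by blast
  define co where "co = (\<lambda>U. openin mtopology U \<and> compactin mtopology U)"
  have co_Un: "co (U \<union> U')" if "co U" "co U'" for U U'
    using that by (auto simp: co_def intro: compactin_Un)
  have "\<exists>V. \<forall>n. co (V n) \<and> (V n \<subseteq> V (Suc n) \<and> from_nat_into \<W> n \<subseteq> V (Suc n)
      \<and> (\<exists>x y. x \<noteq> y \<and> {x, y} \<subseteq> V (Suc n) - V n))"
  proof (rule dependent_nat_choice)
    show "\<exists>U. co U" by (rule exI[of _ "{}"]) (simp add: co_def)
    fix U n assume U: "co U"
    \<comment> \<open>Otherwise the whole space would be the union of a compact and a finite set,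
      hence compact.\<close>
    have "infinite (M - U)"
    proof
      assume "finite (M - U)"
      then have "compactin mtopology (U \<union> (M - U))"
        using U by (intro compactin_Un[OF _ finite_imp_compactin]) (auto simp: co_def)
      moreover have "U \<subseteq> M" using U openin_subset unfolding co_def by fastforce
      then have "U \<union> (M - U) = M" by blast
      ultimately show False using nc by (simp add: compact_space_def)
    qed
    then obtain F where F: "finite F" "card F = 2" "F \<subseteq> M - U"
      using infinite_arbitrarily_large by blast
    then obtain x y where xy: "x \<noteq> y" "{x, y} \<subseteq> M - U" by (auto simp: card_2_iff)
    then obtain A B where AB: "A \<in> \<W>" "x \<in> A" "B \<in> \<W>" "y \<in> B" using W(3) by blast
    have "co A" "co B" "co (from_nat_into \<W> n)"
      using W(2) AB from_nat_into[OF Wne] by (auto simp: co_def)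
    then have "co (U \<union> from_nat_into \<W> n \<union> A \<union> B)" using U by (intro co_Un)
    moreover have "{x, y} \<subseteq> (U \<union> from_nat_into \<W> n \<union> A \<union> B) - U" using xy AB by blast
    ultimately show "\<exists>U'. co U' \<and> U \<subseteq> U' \<and> from_nat_into \<W> n \<subseteq> U'
        \<and> (\<exists>x y. x \<noteq> y \<and> {x, y} \<subseteq> U' - U)"
      using xy(1) by (intro exI[of _ "U \<union> from_nat_into \<W> n \<union> A \<union> B"]) blast
  qed
  then obtain V where V: "\<And>n. co (V n)" "\<And>n. V n \<subseteq> V (Suc n)" "\<And>n. from_nat_into \<W> n \<subseteq> V (Suc n)"
    "\<And>n. \<exists>x y. x \<noteq> y \<and> {x, y} \<subseteq> V (Suc n) - V n" by metis
  have "\<exists>n. x \<in> V n" if x: "x \<in> M" for x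
  proof -
    obtain A where "A \<in> \<W>" "x \<in> A" using W(3) x by blast
    moreover from this obtain n where "A = from_nat_into \<W> n"
      using range_from_nat_into[OF Wne W(1)] by (metis rangeE)
    ultimately show ?thesis using V(3) by blast
  qed
  moreover have "openin mtopology (V n)" "compactin mtopology (V n)" for n
    using V(1) by (auto simp: co_def)
  ultimately show thesis using V(2,4) that by blast
qed

text \<open>The new metric is the old one, truncated at 1, inside each difference of consecutive sets of the
  exhaustion; the differences are then balls of radius 3/2.\<close>

lemma exists_proper_with_partition:
  assumes lc: "locally_compact_space mtopology" and sep: "separable_space mtopology"
    and nc: "\<not> compact_space mtopology"
  obtains d' \<P> where "Ultrametric_space M d'" "Metric_space.proper_metric M d'"
    "Metric_space.mtopology M d' = mtopology"
    "partition_on M \<P>" "\<P> \<subseteq> Metric_space.mballs M d'" "infinite {Q \<in> \<P>. \<not> is_singleton Q}"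
proof -
  obtain V :: "nat \<Rightarrow> 'a set" where V: "\<And>n. openin mtopology (V n)" "\<And>n. compactin mtopology (V n)"
    "\<And>n. V n \<subseteq> V (Suc n)" "\<And>x. x \<in> M \<Longrightarrow> \<exists>n. x \<in> V n"
    "\<And>n. \<exists>x y. x \<noteq> y \<and> {x, y} \<subseteq> V (Suc n) - V n"
    using compact_open_exhaustion[OF lc sep nc] by metis
  have VM: "V n \<subseteq> M" for n using openin_subset[OF V(1)] by simp
  have Vmono: "V m \<subseteq> V n" if "m \<le> n" for m n using lift_Suc_mono_le[of V] V(3) that by blast
  define idx where "idx x = (LEAST n. x \<in> V n)" for x
  have idx_le: "idx x \<le> n \<longleftrightarrow> x \<in> V n" if "x \<in> M" for x n
  proof
    assume le: "idx x \<le> n"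
    have "x \<in> V (idx x)" unfolding idx_def using V(4)[OF that] by (rule LeastI_ex)
    then show "x \<in> V n" using Vmono[OF le] by blast
  next
    show "x \<in> V n \<Longrightarrow> idx x \<le> n" unfolding idx_def by (rule Least_le)
  qed
  \<comment> \<open>Different indices have maximum at least 1, so distances across layers are at
    least 2, above the truncation at 1. They grow with the index, which makes bounded sets lie in
    some \<open>V n\<close>.\<close>
  define d' where "d' x y = (if idx x = idx y then min (d x y) 1 else 1 + real (max (idx x) (idx y)))" for x y
  have d'0: "0 \<le> d' x y" for x y by (simp add: d'_def)
  have far: "2 \<le> d' x y" if "idx x \<noteq> idx y" for x y
    using that by (auto simp: d'_def)
  have ultra: "d' x y \<le> max (d' x z) (d' z y)" if M: "x \<in> M" "y \<in> M" "z \<in> M" for x y z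
    using ultrametric[OF M] by (auto simp: d'_def)
  interpret N: Ultrametric_space M d'
  proof
    fix x y z
    show "0 \<le> d' x y" by (rule d'0)
    show "d' x y = d' y x" by (simp add: d'_def commute max.commute)
    show "d' x y = 0 \<longleftrightarrow> x = y" if "x \<in> M" "y \<in> M"
      using that by (auto simp: d'_def min_def)
    show "d' x z \<le> d' x y + d' y z" if "x \<in> M" "y \<in> M" "z \<in> M"
      using ultra[of x z y] that d'0[of x y] d'0[of y z] by linarith
    show "d' x y \<le> max (d' x z) (d' z y)" if "x \<in> M" "y \<in> M" "z \<in> M"
      using ultra that by blast
  qed
  have near: "\<exists>\<delta>>0. \<forall>y\<in>M. d x y < \<delta> \<longrightarrow> idx y = idx x" if x: "x \<in> M" for x
  proof -
    \<comment> \<open>A layer is open: the finitely many earlier sets removed are compact, hence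
      closed.\<close>
    have "openin mtopology (V (idx x) - \<Union>(V ` {..<idx x}))"
      using V(1,2) Hausdorff_space_mtopology
      by (intro openin_diff closedin_Union) (auto intro: compactin_imp_closedin)
    moreover have "x \<in> V (idx x) - \<Union>(V ` {..<idx x})"
      using idx_le[OF x] by (auto simp: not_le[symmetric])
    ultimately obtain \<delta> where \<delta>: "\<delta> > 0" "mball x \<delta> \<subseteq> V (idx x) - \<Union>(V ` {..<idx x})"
      unfolding openin_mtopology by blast
    have "idx y = idx x" if y: "y \<in> M" "d x y < \<delta>" for y
    proof (rule antisym)
      have "y \<in> V (idx x) - \<Union>(V ` {..<idx x})" using \<delta>(2) x y by auto
      then show "idx y \<le> idx x" "idx x \<le> idx y"
        using idx_le[OF y(1)] by (auto simp: not_less[symmetric])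
    qed
    then show ?thesis using \<delta>(1) by blast
  qed
  have top: "N.mtopology = mtopology"
  proof (rule mtopology_eqI)
    show "Metric_space M d" "Metric_space M d'" by (fact Metric_space_axioms, fact N.Metric_space_axioms)
    fix x and e :: real assume x: "x \<in> M" and e: "e > 0"
    obtain \<delta> where \<delta>: "\<delta> > 0" "\<forall>y\<in>M. d x y < \<delta> \<longrightarrow> idx y = idx x" using near[OF x] by blast
    have "d' x y < e" if "y \<in> M" "d x y < min \<delta> e" for y
      using that \<delta> by (auto simp: d'_def)
    then show "\<exists>\<delta>>0. \<forall>y\<in>M. d x y < \<delta> \<longrightarrow> d' x y < e"
      using \<delta>(1) e by (intro exI[of _ "min \<delta> e"]) auto
    have "d x y < e" if "y \<in> M" "d' x y < min 1 e" for y
    proof -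
      have "idx x = idx y" using far[of x y] that by fastforce
      then show ?thesis using that by (auto simp: d'_def)
    qed
    then show "\<exists>\<delta>>0. \<forall>y\<in>M. d' x y < \<delta> \<longrightarrow> d x y < e"
      using e by (intro exI[of _ "min 1 e"]) auto
  qed
  have "N.proper_metric"
    unfolding N.proper_metric_def
  proof (intro ballI allI)
    fix a and r :: real assume a: "a \<in> M"
    \<comment> \<open>A point of the ball either has the same index as \<open>a\<close>, or
      satisfies \<open>1 + idx y \<le> r\<close>.\<close>
    define n where "n = max (idx a) (nat \<lceil>r\<rceil>)"
    have "N.mcball a r \<subseteq> V n"
    proof
      fix y assume y: "y \<in> N.mcball a r"
      then have "idx y \<le> n"
        by (cases "idx a = idx y") (auto simp: d'_def n_def le_max_iff_disj, linarith+)
      then show "y \<in> V n" using idx_le y by simp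
    qed
    then show "compactin N.mtopology (N.mcball a r)"
      using closed_compactin V(2) N.closedin_mcball top by metis
  qed
  moreover define L where "L n = {x \<in> M. idx x = n}" for n
  have L_Suc: "x \<in> L (Suc n)" if x: "x \<in> V (Suc n) - V n" for x n
  proof -
    have "x \<in> M" using x VM by blast
    moreover from this have "idx x \<le> Suc n" "\<not> idx x \<le> n" using idx_le x by auto
    ultimately show ?thesis by (simp add: L_def)
  qed
  have L_two: "\<not> is_singleton (L (Suc n))" for n
  proof -
    obtain x y where xy: "x \<noteq> y" "{x, y} \<subseteq> V (Suc n) - V n" using V(5) by blast
    then have "{x, y} \<subseteq> L (Suc n)" using L_Suc by blast
    then show ?thesis using xy(1) by (auto simp: is_singleton_def)
  qed
  \<comment> \<open>Layer 0 may be empty, so the empty set is removed; only the layers of positive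
    index are known to have two points.\<close>
  have "partition_on M (range L - {{}})"
    by (rule partition_onI) (auto simp: L_def disjnt_def)
  moreover have "range L - {{}} \<subseteq> N.mballs"
  proof
    fix B assume "B \<in> range L - {{}}"
    then obtain x where x: "x \<in> M" "B = L (idx x)" by (auto simp: L_def)
    have "y \<in> B \<longleftrightarrow> y \<in> N.mball x (3/2)" for y
    proof (cases "idx x = idx y")
      case True
      then show ?thesis using x by (auto simp: L_def d'_def)
    next
      case False
      then show ?thesis using far[OF False] x by (auto simp: L_def)
    qed
    then have "B = N.mball x (3/2)" by blast
    moreover have "(0::real) < 3/2" by simp
    ultimately show "B \<in> N.mballs" using x(1) unfolding N.mballs_def by blast
  qed
  moreover have "infinite {Q \<in> range L - {{}}. \<not> is_singleton Q}"
  proof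
    assume "finite {Q \<in> range L - {{}}. \<not> is_singleton Q}"
    moreover have Lne: "L (Suc n) \<noteq> {}" for n
      using V(5)[of n] L_Suc by blast
    then have "range (\<lambda>n. L (Suc n)) \<subseteq> {Q \<in> range L - {{}}. \<not> is_singleton Q}"
      using L_two by auto
    ultimately have "finite (range (\<lambda>n. L (Suc n)))" by (rule rev_finite_subset)
    moreover have "inj (\<lambda>n. L (Suc n))"
    proof (rule injI)
      fix m n assume eq: "L (Suc m) = L (Suc n)"
      obtain x where "x \<in> L (Suc m)" using Lne by blast
      then have "x \<in> L (Suc m)" "x \<in> L (Suc n)" using eq by simp_all
      then show "m = n" by (simp add: L_def)
    qed
    ultimately show False using finite_imageD by blast
  qed
  ultimately show thesis using that N.Ultrametric_space_axioms top by blast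
qed

end

theorem theorem1p1:
  fixes X :: "'a set" and d :: "'a \<Rightarrow> 'a \<Rightarrow> real" and M :: "real set"
  assumes "Ultrametric_space X d"
    and "locally_compact_space (Metric_space.mtopology X d)"
    and "\<not> compact_space (Metric_space.mtopology X d)"
    and "separable_space (Metric_space.mtopology X d)"
    and "M \<subseteq> {0..}" and "countable M" and "\<not> bounded M" and "0 \<in> M"
    and "(\<exists>x\<in>X. \<not> openin (Metric_space.mtopology X d) {x}) \<longrightarrow> 0 islimpt M"
  shows "(\<exists>d'. Ultrametric_space X d' \<and> Metric_space.proper_metric X d'
              \<and> Metric_space.mtopology X d' = Metric_space.mtopology X d
              \<and> Metric_space.dist_range X d' = M)
       \<and> (Metric_space.proper_metric X d
            \<and> (\<exists>\<P>. partition_on X \<P> \<and> \<P> \<subseteq> Metric_space.mballs X d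
                     \<and> infinite {P \<in> \<P>. \<not> is_singleton P})
          \<longrightarrow> (\<exists>d'. Ultrametric_space X d' \<and> Metric_space.proper_metric X d'
                    \<and> Metric_space.mtopology X d' = Metric_space.mtopology X d
                    \<and> Metric_space.dist_range X d' = M
                    \<and> Metric_space.mballs X d' = Metric_space.mballs X d))"
proof -
  interpret Ultrametric_space X d by fact
  show ?thesis
  proof (intro conjI impI)
    obtain d1 \<P> where d1: "Ultrametric_space X d1" "Metric_space.proper_metric X d1"
      "Metric_space.mtopology X d1 = mtopology"
      "partition_on X \<P>" "\<P> \<subseteq> Metric_space.mballs X d1" "infinite {Q \<in> \<P>. \<not> is_singleton Q}"
      by (rule exists_proper_with_partition[OF assms(2,4,3)])
    then interpret N: Ultrametric_space X d1 by blast
    show "\<exists>d'. Ultrametric_space X d' \<and> Metric_space.proper_metric X d'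
              \<and> Metric_space.mtopology X d' = mtopology \<and> Metric_space.dist_range X d' = M"
      \<comment> \<open>The hypotheses on non-compactness and isolated points speak of the topology
        alone, so they pass from \<open>d\<close> to \<open>d1\<close>.\<close>
      using N.remetrize_with_range[OF d1(2) _ d1(4-6) assms(5-8)] assms(3,9) unfolding d1(3) by blast
  next
    assume "proper_metric \<and> (\<exists>\<P>. partition_on X \<P> \<and> \<P> \<subseteq> mballs
                     \<and> infinite {P \<in> \<P>. \<not> is_singleton P})"
    then obtain \<P> where "proper_metric" "partition_on X \<P>" "\<P> \<subseteq> mballs"
      "infinite {P \<in> \<P>. \<not> is_singleton P}" by blast
    then show "\<exists>d'. Ultrametric_space X d' \<and> Metric_space.proper_metric X d'
                    \<and> Metric_space.mtopology X d' = mtopology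
                    \<and> Metric_space.dist_range X d' = M
                    \<and> Metric_space.mballs X d' = mballs"
      by (rule remetrize_with_range[OF _ assms(3) _ _ _ assms(5-9)])
  qed
qed

end
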